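(* Let $\alpha \ge 1$ be an integer and let $G=(V,E)$ be a finite simple graph of arboricity at most $\alpha$ whose edges are presented as a stream $e_1, e_2, \ldots, e_m$ in an arbitrary order (each edge appearing exactly once). Let $E_\alpha \subseteq E$ be the set of edges $uv$ such that at most $\alpha$ edges incident to $u$ appear in the stream after $uv$, and at most $\alpha$ edges incident to $v$ appear in the stream after $uv$. Then $$\mathrm{match}(G) \le |E_\alpha| \le (\alpha+2)\,\mathrm{match}(G),$$ where $\mathrm{match}(G)$ denotes the maximum size of a matching in $G$.
   Context: A graph has arboricity at most $\alpha$ if its edge set can be partitioned into at most $\alpha$ forests. $\mathrm{match}(G)$ is the maximum number of edges in a matching of $G$. *)

theory Defs
  imports Main "HOL-Library.Disjoint_Sets"
begin

text \<open>Undirected edges are two-element vertex sets.\<close>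

definition finite_simple_graph :: "'a set \<Rightarrow> 'a set set \<Rightarrow> bool" where
  "finite_simple_graph V E \<longleftrightarrow> finite V \<and> (\<forall>e\<in>E. e \<subseteq> V \<and> card e = 2)"

text \<open>A cycle is given by its vertices in cyclic order.\<close>

definition is_cycle :: "'a set set \<Rightarrow> 'a list \<Rightarrow> bool" where
  "is_cycle F vs \<longleftrightarrow> 3 \<le> length vs \<and> distinct vs \<and>
     (\<forall>i<length vs. {vs ! i, vs ! (Suc i mod length vs)} \<in> F)"

definition is_forest :: "'a set set \<Rightarrow> bool" where
  "is_forest F \<longleftrightarrow> (\<nexists>vs. is_cycle F vs)"

definition arboricity_at_most :: "'a set set \<Rightarrow> nat \<Rightarrow> bool" where
  "arboricity_at_most E k \<longleftrightarrow>
     (\<exists>P. partition_on E P \<and> finite P \<and> card P \<le> k \<and> (\<forall>F\<in>P. is_forest F))"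

definition is_matching :: "'a set set \<Rightarrow> 'a set set \<Rightarrow> bool" where
  "is_matching E M \<longleftrightarrow> M \<subseteq> E \<and> disjoint M"

text \<open>Meaningful for finite \<open>E\<close> only; the empty matching makes the set nonempty.\<close>

definition match_number :: "'a set set \<Rightarrow> nat" where
  "match_number E = Max (card ` {M. is_matching E M})"

definition is_stream_of :: "'a set list \<Rightarrow> 'a set set \<Rightarrow> bool" where
  "is_stream_of es E \<longleftrightarrow> distinct es \<and> set es = E"

definition edges_after :: "'a set list \<Rightarrow> 'a set \<Rightarrow> 'a set set" where
  "edges_after es e = {es ! j | i j. i < j \<and> j < length es \<and> es ! i = e}"

definition late_edges :: "nat \<Rightarrow> 'a set list \<Rightarrow> 'a set set" where
  "late_edges k es =
     {e \<in> set es. \<forall>u\<in>e. card {f \<in> edges_after es e. u \<in> f} \<le> k}"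

end

theory Submission
  imports Defs
begin

text \<open>
  Lower bound. Let \<open>B u\<close> be the set of the last \<open>\<alpha> + 1\<close> edges at \<open>u\<close>, and call \<open>u\<close> heavy if its
  degree exceeds \<open>\<alpha>\<close>; an edge is late iff it lies in \<open>B u\<close> for both ends \<open>u\<close>. Counting the pairs
  \<open>(u, e)\<close> with \<open>u\<close> heavy and \<open>e \<in> B u\<close>, and using that at most \<open>\<alpha> h\<close> edges join two of the \<open>h\<close>
  heavy vertices, at least \<open>h\<close> late edges meet a heavy vertex. All edges between light vertices are
  late, and a matching has at most \<open>h\<close> edges that meet a heavy vertex.

  Upper bound. The late edges have maximum degree at most \<open>\<alpha> + 1\<close>, so it suffices that a graph of
  maximum degree \<open>D\<close> has at most \<open>D + 1\<close> times as many edges as a maximum matching. A vertex covered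
  by every maximum matching can be deleted. If there is none, then ``no maximum matching misses both
  \<open>u\<close> and \<open>v\<close>'' is an equivalence relation (the argument of Gallai's lemma) whose classes contain
  all the edges, and a maximum matching misses at most one vertex of each class. On a class
  with \<open>m\<close> matching edges, hence at most \<open>2 m + 1\<close> vertices, the bound \<open>(D + 1) m\<close> follows from
  the handshake lemma if \<open>D < 2 m\<close> and from counting all pairs otherwise.
\<close>

section \<open>Forests\<close>

lemma finite_simple_graph_finite:
  assumes "finite_simple_graph V E"
  shows "finite V" "finite E"
proof -
  show "finite V" using assms by (simp add: finite_simple_graph_def)
  moreover have "E \<subseteq> Pow V" using assms by (auto simp: finite_simple_graph_def)
  ultimately show "finite E" by (meson finite_Pow_iff finite_subset)
qed

lemma card_filter_split:
  assumes "finite A"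
  shows "card A = card {x \<in> A. P x} + card {x \<in> A. \<not> P x}"
proof -
  have "A = {x \<in> A. P x} \<union> {x \<in> A. \<not> P x}" by blast
  moreover have "{x \<in> A. P x} \<inter> {x \<in> A. \<not> P x} = {}" by blast
  ultimately show ?thesis
    using assms card_Un_disjoint[of "{x \<in> A. P x}" "{x \<in> A. \<not> P x}"] by simp
qed

lemma card_2_other:
  assumes "card e = 2" "v \<in> e"
  obtains w where "e = {v, w}" "w \<noteq> v"
  using assms by (auto simp: card_2_iff)

lemma finite_Union_edges:
  assumes "finite E" "\<And>e. e \<in> E \<Longrightarrow> card e = 2" "X \<subseteq> E"
  shows "finite (\<Union>X)"
proof (rule finite_Union)
  show "finite X" using assms(1,3) finite_subset by blast
  show "finite e" if "e \<in> X" for e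
    using that assms(2,3) by (intro card_ge_0_finite) auto
qed

text \<open>By maximality of a longest path, every edge at its first vertex ends on the path; an
  edge there other than the path's own first edge closes a cycle.\<close>

lemma min_degree_two_has_cycle:
  assumes G: "finite_simple_graph V F" and "V \<noteq> {}"
    and deg: "\<And>v. v \<in> V \<Longrightarrow> 2 \<le> card {e \<in> F. v \<in> e}"
  shows "\<exists>vs. is_cycle F vs"
proof -
  note fin = finite_simple_graph_finite[OF G]
  define path where "path p \<longleftrightarrow> p \<noteq> [] \<and> distinct p \<and> set p \<subseteq> V \<and>
    (\<forall>i. Suc i < length p \<longrightarrow> {p ! i, p ! Suc i} \<in> F)" for p
  obtain x where "x \<in> V" using \<open>V \<noteq> {}\<close> by blast
  then have "path [x]" by (simp add: path_def)
  moreover have "\<forall>p. path p \<longrightarrow> length p < Suc (card V)"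
    using fin(1) by (auto simp: path_def less_Suc_eq_le distinct_card[symmetric] intro: card_mono)
  ultimately obtain p where p: "path p" and max: "\<And>q. path q \<Longrightarrow> length q \<le> length p"
    using ex_has_greatest_nat[of path "[x]" length "Suc (card V)"] by blast
  define v where "v = p ! 0"
  have "v \<in> V" using p by (auto simp: path_def v_def)
  \<comment> \<open>If \<open>p\<close> has length one, \<open>p ! 1\<close> is unspecified, but the
    set on the right still has a single element, too few for degree two.\<close>
  have "\<not> {e \<in> F. v \<in> e} \<subseteq> {{v, p ! 1}}"
    using deg[OF \<open>v \<in> V\<close>] card_mono[of "{{v, p ! 1}}" "{e \<in> F. v \<in> e}"] by auto
  then obtain e where e: "e \<in> F" "v \<in> e" "e \<noteq> {v, p ! 1}" by blast
  have "card e = 2" "e \<subseteq> V" using G e(1) by (auto simp: finite_simple_graph_def)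
  then obtain w where w: "e = {v, w}" "w \<noteq> v" using card_2_other e(2) by metis
  have "w \<in> set p"
  proof (rule ccontr)
    assume "w \<notin> set p"
    moreover have "{(w # p) ! i, (w # p) ! Suc i} \<in> F" if "Suc i < length (w # p)" for i
      using that p e(1) w(1) by (cases i) (auto simp: path_def v_def insert_commute)
    ultimately have "path (w # p)"
      using p w(1) \<open>e \<subseteq> V\<close> by (auto simp: path_def)
    then show False using max by fastforce
  qed
  then obtain i where i: "i < length p" "w = p ! i" by (auto simp: in_set_conv_nth)
  \<comment> \<open>The choice of \<open>e\<close> different from \<open>{v, p ! 1}\<close> excludes
    \<open>i = 1\<close>, so the part of \<open>p\<close> up to \<open>w\<close> has at least three
    vertices, and \<open>e\<close> closes it.\<close>
  have "i \<noteq> 0" "i \<noteq> 1" using w e(3) i(2) v_def by auto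
  then have "2 \<le> i" by simp
  have "is_cycle F (take (Suc i) p)"
    unfolding is_cycle_def
  proof (intro conjI allI impI)
    show "3 \<le> length (take (Suc i) p)" using \<open>2 \<le> i\<close> i(1) by simp
    show "distinct (take (Suc i) p)" using p by (simp add: path_def)
    fix j assume "j < length (take (Suc i) p)"
    then have j: "j \<le> i" using i(1) by simp
    have len: "length (take (Suc i) p) = Suc i" using i(1) by simp
    show "{take (Suc i) p ! j, take (Suc i) p ! (Suc j mod length (take (Suc i) p))} \<in> F"
    proof (cases "j = i")
      case True
      then show ?thesis using e(1) w i v_def len by (simp add: insert_commute)
    next
      case False
      then show ?thesis using j i(1) p len by (simp add: path_def)
    qed
  qed
  then show ?thesis by blast
qed

lemma is_forest_subset:
  assumes "is_forest F" "F' \<subseteq> F"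
  shows "is_forest F'"
proof -
  have "is_cycle F vs" if "is_cycle F' vs" for vs using that assms(2) by (auto simp: is_cycle_def)
  then show ?thesis using assms(1) by (auto simp: is_forest_def)
qed

text \<open>Having no cycle, a forest on a nonempty vertex set has a vertex of degree at most one;
  deleting it costs one vertex and at most one edge.\<close>

lemma forest_card_le:
  assumes "finite_simple_graph V F" "is_forest F"
  shows "card F \<le> card V"
  using assms
proof (induction "card V" arbitrary: V F rule: less_induct)
  case less
  note fin = finite_simple_graph_finite[OF less.prems(1)]
  show ?case
  proof (cases "V = {}")
    case True
    then have "F = {}" using less.prems(1) by (auto simp: finite_simple_graph_def)
    then show ?thesis by simp
  next
    case False
    then obtain v where v: "v \<in> V" "\<not> 2 \<le> card {e \<in> F. v \<in> e}"
      using min_degree_two_has_cycle[OF less.prems(1)] less.prems(2) by (auto simp: is_forest_def)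
    let ?F = "{e \<in> F. v \<notin> e}"
    have "card (V - {v}) < card V" using v(1) fin(1) by (meson card_Diff1_less)
    moreover have "finite_simple_graph (V - {v}) ?F"
      using less.prems(1) by (auto simp: finite_simple_graph_def)
    moreover have "is_forest ?F" by (rule is_forest_subset[OF less.prems(2)]) auto
    ultimately have "card ?F \<le> card (V - {v})" by (rule less.hyps)
    moreover have "card F = card ?F + card {e \<in> F. v \<in> e}"
      using card_filter_split[OF fin(2), of "\<lambda>e. v \<notin> e"] by simp
    moreover have "card V = Suc (card (V - {v}))" using card_Suc_Diff1[OF fin(1) v(1)] by simp
    ultimately show ?thesis using v(2) by linarith
  qed
qed

text \<open>Each of the at most \<open>k\<close> forests, cut down to its edges inside
  \<open>S\<close>, has at most \<open>card S\<close> edges.\<close>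

lemma arboricity_induced_card_le:
  assumes E: "\<And>e. e \<in> E \<Longrightarrow> card e = 2" and "arboricity_at_most E k" "finite S"
  shows "card {e \<in> E. e \<subseteq> S} \<le> k * card S"
proof -
  obtain P where P: "partition_on E P" "finite P" "card P \<le> k" "\<And>F. F \<in> P \<Longrightarrow> is_forest F"
    using assms(2) by (auto simp: arboricity_at_most_def)
  have "{e \<in> E. e \<subseteq> S} = (\<Union>F\<in>P. {e \<in> F. e \<subseteq> S})"
    using P(1) by (auto simp: partition_on_def)
  then have "card {e \<in> E. e \<subseteq> S} \<le> (\<Sum>F\<in>P. card {e \<in> F. e \<subseteq> S})"
    by (simp only: card_UN_le[OF P(2)])
  also have "\<dots> \<le> (\<Sum>F\<in>P. card S)"
  proof (rule sum_mono)
    fix F assume F: "F \<in> P"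
    then have "F \<subseteq> E" using P(1) by (auto simp: partition_on_def)
    then have "finite_simple_graph S {e \<in> F. e \<subseteq> S}"
      using E \<open>finite S\<close> by (auto simp: finite_simple_graph_def)
    moreover have "is_forest {e \<in> F. e \<subseteq> S}" by (rule is_forest_subset[OF P(4)[OF F]]) auto
    ultimately show "card {e \<in> F. e \<subseteq> S} \<le> card S" by (rule forest_card_le)
  qed
  also have "\<dots> \<le> k * card S" using P(3) by simp
  finally show ?thesis .
qed

section \<open>Matchings\<close>

lemma is_matching_empty: "is_matching E {}"
  by (simp add: is_matching_def)

lemma finite_matchings:
  assumes "finite E"
  shows "finite {M. is_matching E M}"
  by (rule finite_subset[of _ "Pow E"]) (use assms in \<open>auto simp: is_matching_def\<close>)

lemma card_le_match_number:
  assumes "finite E" "is_matching E M"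
  shows "card M \<le> match_number E"
  unfolding match_number_def
  using assms finite_matchings[OF assms(1)] by (intro Max_ge) auto

definition is_max_matching :: "'a set set \<Rightarrow> 'a set set \<Rightarrow> bool" where
  "is_max_matching E M \<longleftrightarrow> is_matching E M \<and> card M = match_number E"

lemma ex_max_matching:
  assumes "finite E"
  shows "\<exists>M. is_max_matching E M"
proof -
  have "Max (card ` {M. is_matching E M}) \<in> card ` {M. is_matching E M}"
    using finite_matchings[OF assms] is_matching_empty by (intro Max_in) auto
  then show ?thesis by (auto simp: is_max_matching_def match_number_def)
qed

lemma match_number_mono:
  assumes "finite E" "E' \<subseteq> E"
  shows "match_number E' \<le> match_number E"
proof -
  obtain M where "is_max_matching E' M" using ex_max_matching assms finite_subset by metis
  then show ?thesis
    using card_le_match_number[OF assms(1), of M] assms(2)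
    by (auto simp: is_max_matching_def is_matching_def)
qed

lemma is_matching_insert:
  assumes "is_matching E M" "e \<in> E" "\<And>g. g \<in> M \<Longrightarrow> e \<inter> g = {}"
  shows "is_matching E (insert e M)"
  using assms by (auto simp: is_matching_def pairwise_insert disjnt_def)

lemma is_matching_subset:
  assumes "is_matching E M" "M' \<subseteq> M"
  shows "is_matching E M'"
  using assms by (auto simp: is_matching_def intro: pairwise_subset)

lemma is_matching_unique:
  assumes "is_matching E M" "e \<in> M" "g \<in> M" "x \<in> e" "x \<in> g"
  shows "e = g"
  using assms by (auto simp: is_matching_def disjoint_def)

lemma card_Union_matching:
  assumes "\<And>e. e \<in> E \<Longrightarrow> card e = 2" "is_matching E M"
  shows "card (\<Union>M) = 2 * card M"
proof -
  have "card (\<Union>M) = sum card M"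
  proof (rule card_Union_disjoint)
    show "disjoint M" using assms(2) by (simp add: is_matching_def)
    show "finite e" if "e \<in> M" for e
      using that assms by (intro card_ge_0_finite) (auto simp: is_matching_def)
  qed
  also have "\<dots> = (\<Sum>e\<in>M. 2)" using assms by (intro sum.cong) (auto simp: is_matching_def)
  finally show ?thesis by simp
qed

text \<open>An edge disjoint from all edges of \<open>M\<close> could be added to
  \<open>M\<close>.\<close>

lemma max_matching_meets_edge:
  assumes "finite E" "is_max_matching E M" "e \<in> E" "e \<noteq> {}"
  shows "e \<inter> \<Union>M \<noteq> {}"
proof
  assume disj: "e \<inter> \<Union>M = {}"
  then have "is_matching E (insert e M)"
    using assms by (intro is_matching_insert) (auto simp: is_max_matching_def)
  then have "card (insert e M) \<le> match_number E" by (rule card_le_match_number[OF assms(1)])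
  moreover have "e \<notin> M" using disj assms(4) by blast
  moreover have "finite M" using assms
    by (auto simp: is_max_matching_def is_matching_def intro: finite_subset)
  ultimately show False using assms(2) by (simp add: is_max_matching_def)
qed

section \<open>The relation of Gallai's lemma\<close>

definition not_both_missed :: "'a set set \<Rightarrow> 'a \<Rightarrow> 'a \<Rightarrow> bool" where
  "not_both_missed E u v \<longleftrightarrow> (\<forall>M. is_max_matching E M \<longrightarrow> u \<in> \<Union>M \<or> v \<in> \<Union>M)"

text \<open>Suppose \<open>M\<close> misses \<open>u\<close> and \<open>v\<close>. A maximum
  matching missing \<open>t\<close> covers both, so by counting it also misses some
  \<open>x \<noteq> t\<close> that \<open>M\<close> covers. An exchange at the \<open>M\<close>-edge
  of \<open>x\<close> gives a maximum matching that still misses \<open>t\<close> and shares one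
  more edge with \<open>M\<close>, which is impossible if the overlap was largest.\<close>

lemma not_both_missed_trans:
  assumes fin: "finite E" and E: "\<And>e. e \<in> E \<Longrightarrow> card e = 2"
    and t: "is_max_matching E N0" "t \<notin> \<Union>N0"
    and ut: "not_both_missed E u t" and tv: "not_both_missed E t v" and "u \<noteq> v"
  shows "not_both_missed E u v"
  unfolding not_both_missed_def
proof (intro allI impI, rule ccontr)
  fix M assume M: "is_max_matching E M" and "\<not> (u \<in> \<Union>M \<or> v \<in> \<Union>M)"
  then have uv: "u \<notin> \<Union>M" "v \<notin> \<Union>M" by auto
  have finm: "finite X" "finite (\<Union>X)" if "is_max_matching E X" for X
  proof -
    have "X \<subseteq> E" using that by (auto simp: is_max_matching_def is_matching_def)
    then show "finite X" "finite (\<Union>X)"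
      using fin E finite_Union_edges by (auto intro: finite_subset)
  qed
  \<comment> \<open>Among the maximum matchings missing \<open>t\<close>, take one that agrees with \<open>M\<close> as much as possible.\<close>
  let ?Q = "\<lambda>N. is_max_matching E N \<and> t \<notin> \<Union>N"
  have "\<forall>N. ?Q N \<longrightarrow> card (M \<inter> N) < Suc (card M)"
    using finm(1)[OF M] by (auto simp: less_Suc_eq_le intro: card_mono)
  then obtain N where N: "is_max_matching E N" "t \<notin> \<Union>N"
    and max: "\<And>N'. is_max_matching E N' \<Longrightarrow> t \<notin> \<Union>N' \<Longrightarrow> card (M \<inter> N') \<le> card (M \<inter> N)"
    using ex_has_greatest_nat[of ?Q N0 "\<lambda>N. card (M \<inter> N)" "Suc (card M)"] t by blast
  have "{u, v} \<subseteq> \<Union>N - \<Union>M"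
    using ut tv N uv by (auto simp: not_both_missed_def)
  then have "2 \<le> card (\<Union>N - \<Union>M)"
    using card_mono[of "\<Union>N - \<Union>M" "{u, v}"] finm(2)[OF N(1)] \<open>u \<noteq> v\<close> by simp
  \<comment> \<open>Maximum matchings cover equally many vertices, so the two differences have the
    same size, at least two.\<close>
  moreover have "card (\<Union>M) = card (\<Union>N)"
    using M N(1) card_Union_matching[OF E] by (simp add: is_max_matching_def)
  then have "card (\<Union>N - \<Union>M) = card (\<Union>M - \<Union>N)"
    using card_le_sym_Diff[OF finm(2)[OF M] finm(2)[OF N(1)]]
      card_le_sym_Diff[OF finm(2)[OF N(1)] finm(2)[OF M]] by simp
  ultimately have "\<not> \<Union>M - \<Union>N \<subseteq> {t}"
    using card_mono[of "{t}" "\<Union>M - \<Union>N"] by auto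
  then obtain x e where x: "e \<in> M" "x \<in> e" "x \<notin> \<Union>N" "x \<noteq> t" by blast
  have "e \<in> E" using M x(1) by (auto simp: is_max_matching_def is_matching_def)
  then obtain y where y: "e = {x, y}" "y \<noteq> x" using card_2_other E x(2) by metis
  have "y \<in> \<Union>N"
    using max_matching_meets_edge[OF fin N(1) \<open>e \<in> E\<close>] x(2,3) y(1) by auto
  then obtain g where g: "g \<in> N" "y \<in> g" by blast
  have Nm: "is_matching E N" and Mm: "is_matching E M"
    using N(1) M by (auto simp: is_max_matching_def)
  \<comment> \<open>The edge \<open>e\<close> of \<open>M\<close> replaces the edge \<open>g\<close>
    of \<open>N\<close> at \<open>y\<close>. As \<open>g\<close> shares \<open>y\<close> with
    \<open>e\<close>, it is not in \<open>M\<close>, so no common edge is lost.\<close>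
  let ?N = "insert e (N - {g})"
  have "is_matching E ?N"
  proof (rule is_matching_insert[OF is_matching_subset[OF Nm] \<open>e \<in> E\<close>])
    show "e \<inter> h = {}" if "h \<in> N - {g}" for h
      using that x(3) y(1) g is_matching_unique[OF Nm, of h g y] by auto
  qed blast
  moreover have "e \<notin> N" using x(2,3) by blast
  then have "card ?N = card N" using g(1) finm(1)[OF N(1)] card.remove[of N g] by simp
  ultimately have "is_max_matching E ?N" using N(1) by (simp add: is_max_matching_def)
  moreover have "t \<notin> \<Union>?N" using x(4) y(1) N(2) \<open>y \<in> \<Union>N\<close> by auto
  ultimately have "card (M \<inter> ?N) \<le> card (M \<inter> N)" by (rule max)
  moreover have "g \<notin> M"
    using is_matching_unique[OF Mm, of g e y] g x y \<open>e \<notin> N\<close> by auto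
  then have "M \<inter> ?N = insert e (M \<inter> N)" using x(1) by auto
  ultimately show False using \<open>e \<notin> N\<close> finm(1)[OF M] by simp
qed

section \<open>Bounding the edges by degree and matching number\<close>

lemma induced_edges_card_le:
  assumes F: "\<And>e. e \<in> F \<Longrightarrow> card e = 2 \<and> e \<subseteq> C" and C: "finite C" "card C \<le> 2 * m + 1"
    and deg: "\<And>v. v \<in> C \<Longrightarrow> card {e \<in> F. v \<in> e} \<le> D"
  shows "card F \<le> (D + 1) * m"
\<comment> \<open>Counting pairs gives at most \<open>(2 * m + 1) * m\<close> edges, the handshake
  lemma at most half of \<open>(2 * m + 1) * D\<close>; the first suffices if
  \<open>2 * m \<le> D\<close>, the second if \<open>D \<le> 2 * m\<close>.\<close>
proof (cases "2 * m \<le> D")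
  case True
  have "card F \<le> card {B. B \<subseteq> C \<and> card B = 2}"
    using F C(1) by (intro card_mono) auto
  also have "\<dots> = card C choose 2" by (rule n_subsets[OF C(1)])
  also have "\<dots> \<le> (2 * m + 1) choose 2" using C(2) by (rule binomial_right_mono)
  also have "\<dots> = (2 * m + 1) * m" by (simp add: choose_two)
  also have "\<dots> \<le> (D + 1) * m" using True by (intro mult_right_mono) auto
  finally show ?thesis .
next
  case False
  have "F \<subseteq> Pow C" using F by auto
  then have "finite F" using C(1) by (meson finite_Pow_iff finite_subset)
  have "\<forall>e\<in>F. card {v \<in> C. v \<in> e} = 2"
  proof
    fix e assume "e \<in> F"
    then have "{v \<in> C. v \<in> e} = e" using F by auto
    then show "card {v \<in> C. v \<in> e} = 2" using F \<open>e \<in> F\<close> by simp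
  qed
  then have "2 * card F = (\<Sum>v\<in>C. card {e \<in> F. v \<in> e})"
    using sum_multicount[OF C(1) \<open>finite F\<close>, of "\<lambda>v e. v \<in> e" 2] by simp
  also have "\<dots> \<le> (\<Sum>v\<in>C. D)" using deg by (rule sum_mono)
  also have "\<dots> \<le> (2 * m + 1) * D" using mult_le_mono1[OF C(2)] by simp
  also have "\<dots> \<le> 2 * ((D + 1) * m)" using False by (simp add: algebra_simps)
  finally show ?thesis by simp
qed

text \<open>No edge joins two Gallai classes, and one fixed maximum matching \<open>M\<close> misses
  at most one vertex of each. So the bound holds class by class, in terms of the edges of
  \<open>M\<close> inside the class, and is then summed.\<close>

lemma card_edges_le_no_essential_vertex:
  assumes fin: "finite E" and E: "\<And>e. e \<in> E \<Longrightarrow> card e = 2"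
    and deg: "\<And>v. card {e \<in> E. v \<in> e} \<le> D"
    and miss: "\<And>v. v \<in> \<Union>E \<Longrightarrow> \<exists>M. is_max_matching E M \<and> v \<notin> \<Union>M"
  shows "card E \<le> (D + 1) * match_number E"
proof -
  obtain M where M: "is_max_matching E M" using ex_max_matching[OF fin] by blast
  then have ME: "M \<subseteq> E" by (auto simp: is_max_matching_def is_matching_def)
  then have "finite M" using fin finite_subset by blast
  have finV: "finite (\<Union>E)" using finite_Union_edges[OF fin E] by blast
  \<comment> \<open>The diagonal is added by hand, since \<open>not_both_missed E u u\<close> would
    say that every maximum matching covers \<open>u\<close>, which \<open>miss\<close>
    excludes.\<close>
  define R where
    "R = {(u, v). u \<in> \<Union>E \<and> v \<in> \<Union>E \<and> (u = v \<or> not_both_missed E u v)}"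
  have R_refl: "(u, u) \<in> R" if "u \<in> \<Union>E" for u using that by (simp add: R_def)
  have R_sym: "(v, u) \<in> R" if "(u, v) \<in> R" for u v
    using that by (auto simp: R_def not_both_missed_def)
  have R_trans: "(u, w) \<in> R" if "(u, v) \<in> R" "(v, w) \<in> R" for u v w
  proof (cases "u = v \<or> v = w \<or> u = w")
    case True
    then show ?thesis using that by (auto simp: R_def)
  next
    case False
    then have V: "u \<in> \<Union>E" "v \<in> \<Union>E" "w \<in> \<Union>E"
      and uv: "not_both_missed E u v" and vw: "not_both_missed E v w"
      using that by (auto simp: R_def)
    obtain N where "is_max_matching E N" "v \<notin> \<Union>N" using miss[OF V(2)] by blast
    then have "not_both_missed E u w"
      using not_both_missed_trans[OF fin E _ _ uv vw] False by blast
    then show ?thesis using V by (simp add: R_def)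
  qed
  have eq: "equiv (\<Union>E) R"
  proof (rule equivI)
    show "R \<subseteq> \<Union>E \<times> \<Union>E" by (auto simp: R_def)
    show "refl_on (\<Union>E) R" using R_refl by (intro refl_onI)
    show "sym R" using R_sym by (intro symI)
    show "trans R" using R_trans by (intro transI)
  qed
  \<comment> \<open>Every maximum matching meets every edge, so the two ends are never both
    missed.\<close>
  have edge_R: "(u, v) \<in> R" if "e \<in> E" "u \<in> e" "v \<in> e" for e u v
  proof (cases "u = v")
    case True
    then show ?thesis using that by (auto simp: R_def)
  next
    case False
    then have "e = {u, v}" using E[OF that(1)] that by (auto simp: card_2_iff)
    moreover have "e \<inter> \<Union>N \<noteq> {}" if "is_max_matching E N" for N
      using max_matching_meets_edge[OF fin that \<open>e \<in> E\<close>] \<open>e = {u, v}\<close> by simp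
    ultimately have "not_both_missed E u v" by (fastforce simp: not_both_missed_def)
    then show ?thesis using that by (auto simp: R_def)
  qed
  define Q where "Q = \<Union>E // R"
  have "finite Q" unfolding Q_def using finV eq by (intro finite_quotient) (auto simp: R_def)
  have edge_class: "e \<subseteq> C" if "C \<in> Q" "e \<in> E" "x \<in> e" "x \<in> C" for C e x
  proof
    fix y assume "y \<in> e"
    then have "(x, y) \<in> R" using edge_R that by blast
    then show "y \<in> C"
      using that in_quotient_imp_closed[OF eq] unfolding Q_def by blast
  qed
  have "E = (\<Union>C\<in>Q. {e \<in> E. e \<subseteq> C})"
  proof (intro equalityI subsetI)
    fix e assume e: "e \<in> E"
    then obtain x where x: "x \<in> e" using E by fastforce
    then have "x \<in> \<Union>Q" using e Union_quotient[OF eq] by (auto simp: Q_def)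
    then obtain C where "C \<in> Q" "x \<in> C" by blast
    then show "e \<in> (\<Union>C\<in>Q. {e \<in> E. e \<subseteq> C})" using edge_class e x by blast
  qed auto
  then have "card E \<le> (\<Sum>C\<in>Q. card {e \<in> E. e \<subseteq> C})"
    using card_UN_le[OF \<open>finite Q\<close>] by metis
  also have "\<dots> \<le> (\<Sum>C\<in>Q. (D + 1) * card {e \<in> M. e \<subseteq> C})"
  proof (rule sum_mono, rule induced_edges_card_le)
    fix C assume C: "C \<in> Q"
    then have CV: "C \<subseteq> \<Union>E" using Union_quotient[OF eq] by (auto simp: Q_def)
    then show "finite C" using finV finite_subset by blast
    have "card (C - \<Union>M) \<le> 1"
    proof (rule ccontr)
      assume "\<not> card (C - \<Union>M) \<le> 1"
      then obtain u v where uv: "u \<in> C - \<Union>M" "v \<in> C - \<Union>M" "u \<noteq> v"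
        using card_le_Suc0_iff_eq[of "C - \<Union>M"] \<open>finite C\<close> by auto
      then have "(u, v) \<in> R" using quotient_eq_iff[OF eq, of C C u v] C by (auto simp: Q_def)
      then show False using uv M by (auto simp: R_def not_both_missed_def)
    qed
    moreover have "card (\<Union>{e \<in> M. e \<subseteq> C}) = 2 * card {e \<in> M. e \<subseteq> C}"
      using M by (intro card_Union_matching[of E])
        (auto simp: E is_max_matching_def intro: is_matching_subset)
    \<comment> \<open>A covered vertex of \<open>C\<close> has its matching edge inside
      \<open>C\<close>, because edges stay within one class.\<close>
    moreover have "C = \<Union>{e \<in> M. e \<subseteq> C} \<union> (C - \<Union>M)"
      using edge_class[OF C] ME by blast
    then have "card C \<le> card (\<Union>{e \<in> M. e \<subseteq> C}) + card (C - \<Union>M)"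
      using card_Un_le by metis
    ultimately show "card C \<le> 2 * card {e \<in> M. e \<subseteq> C} + 1" by linarith
    show "card {e \<in> {e \<in> E. e \<subseteq> C}. v \<in> e} \<le> D" for v
      using card_mono[of "{e \<in> E. v \<in> e}" "{e \<in> {e \<in> E. e \<subseteq> C}. v \<in> e}"] fin deg[of v] by force
  qed (auto simp: E)
  also have "\<dots> = (D + 1) * (\<Sum>C\<in>Q. card {e \<in> M. e \<subseteq> C})" by (simp add: sum_distrib_left)
  finally have le: "card E \<le> (D + 1) * (\<Sum>C\<in>Q. card {e \<in> M. e \<subseteq> C})" .
  have "(\<Sum>C\<in>Q. card {e \<in> M. e \<subseteq> C}) = card (\<Union>C\<in>Q. {e \<in> M. e \<subseteq> C})"
  proof (rule card_UN_disjoint[symmetric])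
    show "\<forall>C\<in>Q. \<forall>C'\<in>Q. C \<noteq> C' \<longrightarrow> {e \<in> M. e \<subseteq> C} \<inter> {e \<in> M. e \<subseteq> C'} = {}"
    proof (intro ballI impI equals0I)
      fix C C' e assume C: "C \<in> Q" "C' \<in> Q" "C \<noteq> C'" and e: "e \<in> {e \<in> M. e \<subseteq> C} \<inter> {e \<in> M. e \<subseteq> C'}"
      then have "C \<inter> C' = {}" using quotient_disj[OF eq] by (auto simp: Q_def)
      then have "e = {}" using e by blast
      then show False using e E ME by fastforce
    qed
  qed (use \<open>finite Q\<close> \<open>finite M\<close> in auto)
  also have "\<dots> \<le> card M" using \<open>finite M\<close> by (intro card_mono) auto
  also have "card M = match_number E" using M by (simp add: is_max_matching_def)
  finally show ?thesis using le by (meson le_trans mult_le_mono2)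
qed

text \<open>Deleting a vertex covered by every maximum matching removes at most \<open>D\<close>
  edges and lowers the matching number by at least one, which pays for them. If there is no such
  vertex, the Gallai classes give the bound.\<close>

lemma card_edges_le_match_number:
  assumes "finite E" "\<And>e. e \<in> E \<Longrightarrow> card e = 2" "\<And>v. card {e \<in> E. v \<in> e} \<le> D"
  shows "card E \<le> (D + 1) * match_number E"
  using assms
proof (induction "card E" arbitrary: E rule: less_induct)
  case less
  note fin = less.prems(1)
  show ?case
  proof (cases "\<exists>v\<in>\<Union>E. \<forall>M. is_max_matching E M \<longrightarrow> v \<in> \<Union>M")
    case False
    then show ?thesis using less.prems by (intro card_edges_le_no_essential_vertex) auto
  next
    case True
    then obtain v where v: "v \<in> \<Union>E" "\<And>M. is_max_matching E M \<Longrightarrow> v \<in> \<Union>M" by blast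
    let ?E = "{e \<in> E. v \<notin> e}"
    have "?E \<subset> E" using v(1) by blast
    then have "card ?E < card E" using fin by (rule psubset_card_mono[rotated])
    moreover have "card {e \<in> ?E. u \<in> e} \<le> D" for u
      using card_mono[of "{e \<in> E. u \<in> e}" "{e \<in> ?E. u \<in> e}"] fin less.prems(3)[of u] by force
    ultimately have IH: "card ?E \<le> (D + 1) * match_number ?E"
      using fin less.prems(2) by (intro less.hyps) auto
    obtain M where M: "is_max_matching ?E M" using ex_max_matching[of ?E] fin by auto
    \<comment> \<open>Otherwise \<open>M\<close> would be a maximum matching of \<open>E\<close> as
      well, yet it misses \<open>v\<close>.\<close>
    have "match_number ?E \<noteq> match_number E"
    proof
      assume "match_number ?E = match_number E"
      then have "is_max_matching E M" using M by (auto simp: is_max_matching_def is_matching_def)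
      then have "v \<in> \<Union>M" by (rule v(2))
      then show False using M by (auto simp: is_max_matching_def is_matching_def)
    qed
    then have "match_number ?E + 1 \<le> match_number E"
      using match_number_mono[of E ?E] fin by auto
    then have "(D + 1) * (match_number ?E + 1) \<le> (D + 1) * match_number E"
      by (rule mult_le_mono2)
    moreover have "card E = card ?E + card {e \<in> E. v \<in> e}"
      using card_filter_split[OF fin, of "\<lambda>e. v \<notin> e"] by simp
    ultimately show ?thesis using IH less.prems(3)[of v] by simp
  qed
qed

section \<open>Late edges\<close>

lemma edges_after_Cons_same:
  assumes "x \<notin> set xs"
  shows "edges_after (x # xs) x = set xs"
proof (intro equalityI subsetI)
  fix y assume "y \<in> edges_after (x # xs) x"
  then obtain i j where ij: "i < j" "j < length (x # xs)" "y = (x # xs) ! j"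
    by (auto simp: edges_after_def)
  then show "y \<in> set xs" by (cases j) auto
next
  fix y assume "y \<in> set xs"
  then obtain j where "j < length xs" "y = xs ! j" by (auto simp: in_set_conv_nth)
  then have "0 < Suc j \<and> Suc j < length (x # xs) \<and> (x # xs) ! 0 = x \<and> y = (x # xs) ! Suc j"
    by simp
  then show "y \<in> edges_after (x # xs) x" unfolding edges_after_def by blast
qed

lemma edges_after_Cons_other:
  assumes "y \<noteq> x"
  shows "edges_after (x # xs) y = edges_after xs y"
proof (intro equalityI subsetI)
  fix z assume "z \<in> edges_after (x # xs) y"
  then obtain i j where ij: "i < j" "j < length (x # xs)" "z = (x # xs) ! j" "(x # xs) ! i = y"
    by (auto simp: edges_after_def)
  then obtain i' where "i = Suc i'" using assms by (cases i) auto
  moreover obtain j' where "j = Suc j'" using ij(1) by (cases j) auto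
  ultimately show "z \<in> edges_after xs y" using ij by (auto simp: edges_after_def)
next
  fix z assume "z \<in> edges_after xs y"
  then obtain i j where "i < j" "j < length xs" "z = xs ! j" "xs ! i = y"
    by (auto simp: edges_after_def)
  then have "Suc i < Suc j \<and> Suc j < length (x # xs) \<and> (x # xs) ! Suc i = y \<and> z = (x # xs) ! Suc j"
    by simp
  then show "z \<in> edges_after (x # xs) y" unfolding edges_after_def by blast
qed

text \<open>For a stream without repetitions this is \<open>B u\<close>, with \<open>k\<close> for
  \<open>\<alpha>\<close>: an edge at \<open>u\<close> is among the last \<open>k + 1\<close> iff at
  most \<open>k\<close> edges at \<open>u\<close> follow it.\<close>

definition last_edges :: "nat \<Rightarrow> 'a set list \<Rightarrow> 'a \<Rightarrow> 'a set set" where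
  "last_edges k es u = {e \<in> set es. u \<in> e \<and> card {f \<in> edges_after es e. u \<in> f} \<le> k}"

lemma late_edges_eq: "late_edges k es = {e \<in> set es. \<forall>u\<in>e. e \<in> last_edges k es u}"
  by (auto simp: late_edges_def last_edges_def)

text \<open>Read the stream from its end: an edge at \<open>u\<close> is taken exactly as long as at
  most \<open>k\<close> edges at \<open>u\<close> were read before it.\<close>

lemma card_last_edges:
  assumes "distinct es"
  shows "card (last_edges k es u) = min (k + 1) (card {e \<in> set es. u \<in> e})"
  using assms
proof (induction es)
  case Nil
  then show ?case by (simp add: last_edges_def)
next
  case (Cons x xs)
  then have x: "x \<notin> set xs" by simp
  let ?d = "card {e \<in> set xs. u \<in> e}"
  have IH: "card (last_edges k xs u) = min (k + 1) ?d" using Cons by simp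
  have nin: "x \<notin> last_edges k xs u" "finite (last_edges k xs u)"
    using x by (auto simp: last_edges_def)
  \<comment> \<open>The new first edge \<open>x\<close> is followed by all of \<open>xs\<close>,
    hence by \<open>?d\<close> edges at \<open>u\<close>; nothing changes for the other
    edges.\<close>
  have "e \<in> last_edges k (x # xs) u \<longleftrightarrow>
    e \<in> (if u \<in> x \<and> ?d \<le> k then insert x (last_edges k xs u) else last_edges k xs u)" for e
    using x nin(1) edges_after_Cons_same[OF x] edges_after_Cons_other[of e x xs]
    by (cases "e = x") (auto simp: last_edges_def)
  then have step: "last_edges k (x # xs) u =
      (if u \<in> x \<and> ?d \<le> k then insert x (last_edges k xs u) else last_edges k xs u)"
    by blast
  show ?case
  proof (cases "u \<in> x")
    case True
    then have "{e \<in> set (x # xs). u \<in> e} = insert x {e \<in> set xs. u \<in> e}" by auto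
    then have "card {e \<in> set (x # xs). u \<in> e} = Suc ?d" using x by simp
    then show ?thesis using step True IH nin by simp
  next
    case False
    then have "{e \<in> set (x # xs). u \<in> e} = {e \<in> set xs. u \<in> e}" by auto
    then show ?thesis using step False IH by simp
  qed
qed

text \<open>The last edges at \<open>u\<close> form a subset of all edges at \<open>u\<close>, and
  here both have the same size.\<close>

lemma last_edges_light:
  assumes "distinct es" "card {e \<in> set es. u \<in> e} \<le> k + 1"
  shows "last_edges k es u = {e \<in> set es. u \<in> e}"
  using assms card_last_edges[OF assms(1), of k u]
  by (intro card_subset_eq) (auto simp: last_edges_def)

lemma late_edges_degree_le:
  assumes "distinct es"
  shows "card {e \<in> late_edges k es. u \<in> e} \<le> k + 1"
proof -
  have "card {e \<in> late_edges k es. u \<in> e} \<le> card (last_edges k es u)"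
    by (intro card_mono) (auto simp: late_edges_eq last_edges_def)
  then show ?thesis using card_last_edges[OF assms, of k u] by simp
qed

section \<open>Lower bound by counting at heavy vertices\<close>

lemma matching_card_meeting_le:
  assumes "is_matching E M" "finite H"
  shows "card {e \<in> M. e \<inter> H \<noteq> {}} \<le> card H"
proof (rule card_inj_on_le)
  \<comment> \<open>Each edge is sent to a chosen end in \<open>H\<close>; edges of a matching share
    no end, so the map is injective.\<close>
  let ?f = "\<lambda>e. SOME x. x \<in> e \<inter> H"
  have f: "?f e \<in> e \<inter> H" if "e \<in> {e \<in> M. e \<inter> H \<noteq> {}}" for e
    using that someI_ex[of "\<lambda>x. x \<in> e \<inter> H"] by blast
  show "?f ` {e \<in> M. e \<inter> H \<noteq> {}} \<subseteq> H" using f by blast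
  show "inj_on ?f {e \<in> M. e \<inter> H \<noteq> {}}"
  proof (rule inj_onI)
    fix e g assume e: "e \<in> {e \<in> M. e \<inter> H \<noteq> {}}" and g: "g \<in> {e \<in> M. e \<inter> H \<noteq> {}}"
      and "?f e = ?f g"
    then have "?f e \<in> e" "?f e \<in> g" using f[OF e] f[OF g] by auto
    then show "e = g" using is_matching_unique[OF assms(1)] e g by blast
  qed
qed (rule assms(2))

text \<open>There are \<open>(k + 1) * card H\<close> pairs of a heavy vertex and one of its last
  edges. An edge is charged once for being late and meeting \<open>H\<close>, and once for lying
  inside \<open>H\<close>. The arboricity bounds the second kind of charge by
  \<open>k * card H\<close>, so at least \<open>card H\<close> charges are of the first
  kind.\<close>

lemma card_heavy_le_late_edges_meeting:
  assumes G: "finite_simple_graph V (set es)" and "distinct es"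
    and arb: "arboricity_at_most (set es) k"
    and H: "H = {v \<in> V. k + 1 \<le> card {e \<in> set es. v \<in> e}}"
  shows "card H \<le> card {e \<in> late_edges k es. e \<inter> H \<noteq> {}}"
proof -
  have "finite H" using G by (simp add: H finite_simple_graph_def)
  let ?L = "{e \<in> late_edges k es. e \<inter> H \<noteq> {}}" and ?I = "{e \<in> set es. e \<subseteq> H}"
  have count: "card {u \<in> H. e \<in> last_edges k es u} \<le> of_bool (e \<in> ?L) + of_bool (e \<in> ?I)"
    if e: "e \<in> set es" for e
  proof -
    have ce: "card e = 2" "e \<subseteq> V" using G e by (auto simp: finite_simple_graph_def)
    then have fe: "finite e" by (simp add: card_ge_0_finite)
    have sub: "{u \<in> H. e \<in> last_edges k es u} \<subseteq> e \<inter> H" by (auto simp: last_edges_def)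
    have light: "e \<in> last_edges k es u" if "u \<in> e" "u \<notin> H" for u
      using last_edges_light[OF \<open>distinct es\<close>, of u k] that ce(2) e by (auto simp: H)
    show ?thesis
    proof (cases "e \<in> late_edges k es")
      case True
      show ?thesis
      proof (cases "e \<subseteq> H")
        case True': True
        have "card {u \<in> H. e \<in> last_edges k es u} \<le> card e"
          using sub fe by (intro card_mono) auto
        moreover have "e \<inter> H \<noteq> {}" using True' ce(1) by (cases "e = {}") auto
        ultimately show ?thesis using True True' ce(1) e by simp
      next
        case False
        then have "e \<inter> H \<subset> e" by blast
        then have "card (e \<inter> H) < 2" using psubset_card_mono[OF fe, of "e \<inter> H"] ce(1) by simp
        moreover have "card {u \<in> H. e \<in> last_edges k es u} \<le> card (e \<inter> H)"
          using sub fe by (intro card_mono) auto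
        ultimately show ?thesis using True False by (cases "e \<inter> H = {}") auto
      qed
    next
      case False
      \<comment> \<open>The end \<open>w\<close> is heavy, as all edges at a light vertex are last
        edges there. The other end can contribute a pair only if it is heavy too, that is, if
        \<open>e \<subseteq> H\<close>.\<close>
      then obtain w where w: "w \<in> e" "e \<notin> last_edges k es w" using e by (auto simp: late_edges_eq)
      then have wH: "w \<in> H" using light by blast
      have "{u \<in> H. e \<in> last_edges k es u} \<subset> e" using sub w by blast
      then have c1: "card {u \<in> H. e \<in> last_edges k es u} < 2"
        using psubset_card_mono[OF fe] ce(1) by metis
      show ?thesis
      proof (cases "e \<subseteq> H")
        case True
        then show ?thesis using c1 e by simp
      next
        case False': False
        then have "e \<inter> H = {w}" using w(1) wH ce(1) by (auto simp: card_2_iff)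
        then have "u = w" if "u \<in> H" "e \<in> last_edges k es u" for u
          using that by (auto simp: last_edges_def)
        then have "{u \<in> H. e \<in> last_edges k es u} = {}" using w(2) by blast
        then show ?thesis by (metis card.empty le0)
      qed
    qed
  qed
  have "(k + 1) * card H = (\<Sum>u\<in>H. card (last_edges k es u))"
    using card_last_edges[OF \<open>distinct es\<close>, of k] by (simp add: H)
  also have "\<dots> = (\<Sum>u\<in>H. card {e \<in> set es. e \<in> last_edges k es u})"
    by (intro sum.cong refl arg_cong[where f=card]) (auto simp: last_edges_def)
  also have "\<dots> = (\<Sum>e\<in>set es. card {u \<in> H. e \<in> last_edges k es u})"
    using \<open>finite H\<close> by (intro sum_multicount_gen) auto
  also have "\<dots> \<le> (\<Sum>e\<in>set es. of_bool (e \<in> ?L) + of_bool (e \<in> ?I))"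
    using count by (rule sum_mono)
  also have "\<dots> = card (set es \<inter> ?L) + card (set es \<inter> ?I)"
    by (simp add: sum.distrib Int_def)
  also have "set es \<inter> ?L = ?L" by (auto simp: late_edges_def)
  also have "set es \<inter> ?I = ?I" by auto
  also have "card ?I \<le> k * card H"
    using G arb \<open>finite H\<close>
    by (intro arboricity_induced_card_le) (auto simp: finite_simple_graph_def)
  finally show ?thesis by simp
qed

text \<open>A maximum matching is split by \<open>H\<close>: its edges avoiding \<open>H\<close> are
  themselves late, and those meeting \<open>H\<close> number at most \<open>card H\<close>, hence no
  more than the late edges meeting \<open>H\<close>.\<close>

lemma match_number_le_card_late_edges:
  assumes G: "finite_simple_graph V (set es)" and "distinct es"
    and arb: "arboricity_at_most (set es) k"
  shows "match_number (set es) \<le> card (late_edges k es)"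
proof -
  define H where "H = {v \<in> V. k + 1 \<le> card {e \<in> set es. v \<in> e}}"
  let ?L = "late_edges k es"
  have finL: "finite ?L" by (simp add: late_edges_def)
  have "finite H" using G by (simp add: H_def finite_simple_graph_def)
  obtain M where M: "is_matching (set es) M" "card M = match_number (set es)"
    using ex_max_matching[of "set es"] by (auto simp: is_max_matching_def)
  have ME: "M \<subseteq> set es" using M(1) by (simp add: is_matching_def)
  then have "finite M" using finite_subset by blast
  have "card M = card {e \<in> M. e \<inter> H = {}} + card {e \<in> M. e \<inter> H \<noteq> {}}"
    using \<open>finite M\<close> by (rule card_filter_split)
  also have "\<dots> \<le> card {e \<in> ?L. e \<inter> H = {}} + card {e \<in> ?L. e \<inter> H \<noteq> {}}"
  proof (rule add_mono)
    have "e \<in> ?L" if "e \<in> set es" "e \<inter> H = {}" for e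
    proof -
      have "e \<in> last_edges k es u" if "u \<in> e" for u
      proof -
        have "u \<in> V" "u \<notin> H"
          using G \<open>e \<in> set es\<close> \<open>e \<inter> H = {}\<close> that by (auto simp: finite_simple_graph_def)
        then show ?thesis
          using last_edges_light[OF \<open>distinct es\<close>, of u k] \<open>e \<in> set es\<close> that by (simp add: H_def)
      qed
      then show ?thesis using that by (simp add: late_edges_eq)
    qed
    then show "card {e \<in> M. e \<inter> H = {}} \<le> card {e \<in> ?L. e \<inter> H = {}}"
      using ME finL by (intro card_mono) auto
    show "card {e \<in> M. e \<inter> H \<noteq> {}} \<le> card {e \<in> ?L. e \<inter> H \<noteq> {}}"
      using matching_card_meeting_le[OF M(1) \<open>finite H\<close>]
        card_heavy_le_late_edges_meeting[OF G \<open>distinct es\<close> arb H_def] by linarith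
  qed
  also have "\<dots> = card ?L"
    using card_filter_split[OF finL] by metis
  finally show ?thesis using M(2) by simp
qed

theorem theorem1:
  fixes V :: "'a set" and E :: "'a set set" and es :: "'a set list" and \<alpha> :: nat
  assumes "1 \<le> \<alpha>"
    and "finite_simple_graph V E"
    and "arboricity_at_most E \<alpha>"
    and "is_stream_of es E"
  shows "match_number E \<le> card (late_edges \<alpha> es) \<and>
         card (late_edges \<alpha> es) \<le> (\<alpha> + 2) * match_number E"
proof
  have es: "distinct es" "set es = E" using assms(4) by (auto simp: is_stream_of_def)
  show "match_number E \<le> card (late_edges \<alpha> es)"
    using match_number_le_card_late_edges[of V es \<alpha>] assms es by simp
  have LE: "late_edges \<alpha> es \<subseteq> E" using es by (auto simp: late_edges_def)
  have "finite E" using es by auto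
  \<comment> \<open>The edge bound is applied to the graph of late edges, with
    \<open>D = \<alpha> + 1\<close>; its matching number is at most that of
    \<open>E\<close>.\<close>
  have "card (late_edges \<alpha> es) \<le> (\<alpha> + 1 + 1) * match_number (late_edges \<alpha> es)"
    using LE assms(2) \<open>finite E\<close> late_edges_degree_le[OF es(1)]
    by (intro card_edges_le_match_number) (auto simp: finite_simple_graph_def intro: finite_subset)
  also have "\<dots> \<le> (\<alpha> + 2) * match_number E"
    using match_number_mono[OF \<open>finite E\<close> LE] by (intro mult_mono) auto
  finally show "card (late_edges \<alpha> es) \<le> (\<alpha> + 2) * match_number E" .
qed

end
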